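(* Let $a_i>0$ for $1\le i\le r$ with $a_i\ne a_j$ whenever $i\ne j$, and let $C_{\vec n}$ be the multiple Charlier polynomials with parameters $(a_1,\ldots,a_r)$. Let $0<q_j<1$ for $1\le j\le r$ with $\sum_{j=1}^r q_j=1$, and for each positive integer $n$ let $\vec n=(n_1,\ldots,n_r)$ with $n_j=\lfloor q_jn\rfloor$ (so that $|\vec n|/n\to 1$ as $n\to\infty$). Then for every $t>0$ and every $k\in\{1,2,\ldots,r\}$, $$\lim_{n\to\infty,\ n/N\to t}\frac{C_{\vec n+\vec e_k}(Nx)}{N\,C_{\vec n}(Nx)}=x-t,$$ uniformly for $x\in K$, for every compact set $K\subset\mathbb{C}\setminus[0,\infty)$.
   Context: For pairwise distinct $a_1,\ldots,a_r>0$ and a multi-index $\vec n=(n_1,\ldots,n_r)$ of non-negative integers with size $|\vec n|=n_1+\cdots+n_r$, the multiple Charlier polynomial $C_{\vec n}$ with parameters $(a_1,\ldots,a_r)$ is the (unique) monic polynomial of degree $|\vec n|$ such that $$\sum_{k=0}^\infty C_{\vec n}(k)\,k^\ell\,\frac{a_j^k}{k!}=0,\qquad \ell=0,1,\ldots,n_j-1,\quad j=1,\ldots,r$$ (with $k^0=1$ for all $k$, including $k=0$). Its zeros are all real and lie in $(0,\infty)$, so the ratios are well defined for $x\in\mathbb{C}\setminus[0,\infty)$. Here $\vec e_k$ is the $k$th unit vector in $\mathbb{N}^r$. The limit is taken as the positive integers $n,N$ both tend to infinity in such a way that $n/N\to t$. *)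

theory Defs
  imports "HOL-Analysis.Analysis" "HOL-Computational_Algebra.Polynomial"
begin

text \<open>Multi-indices in \<open>\<nat>\<^sup>r\<close> are functions \<open>nat \<Rightarrow> nat\<close> of which only the values on \<open>{1..r}\<close>
  matter; likewise for the parameter vectors \<open>a\<close> and \<open>q\<close>.\<close>

definition multi_size :: "nat \<Rightarrow> (nat \<Rightarrow> nat) \<Rightarrow> nat" where
  "multi_size r n = (\<Sum>j = 1..r. n j)"

definition multi_unit :: "nat \<Rightarrow> nat \<Rightarrow> nat" where
  "multi_unit k = (\<lambda>j. if j = k then 1 else 0)"

text \<open>\<open>sums 0\<close> says that the series converges, with sum 0; note \<open>0 ^ 0 = 1\<close>.\<close>

definition is_multiple_charlier ::
    "nat \<Rightarrow> (nat \<Rightarrow> real) \<Rightarrow> (nat \<Rightarrow> nat) \<Rightarrow> real poly \<Rightarrow> bool" where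
  "is_multiple_charlier r a n p \<longleftrightarrow>
     lead_coeff p = 1 \<and> degree p = multi_size r n \<and>
     (\<forall>j\<in>{1..r}. \<forall>l<n j.
        (\<lambda>k. poly p (real k) * real k ^ l * (a j ^ k / fact k)) sums 0)"

text \<open>Existence and uniqueness hold for pairwise distinct \<open>a 1, \<dots>, a r > 0\<close>; otherwise the
  value may be unspecified.\<close>

definition multiple_charlier ::
    "nat \<Rightarrow> (nat \<Rightarrow> real) \<Rightarrow> (nat \<Rightarrow> nat) \<Rightarrow> real poly" where
  "multiple_charlier r a n = (THE p. is_multiple_charlier r a n p)"

definition charlier_eval ::
    "nat \<Rightarrow> (nat \<Rightarrow> real) \<Rightarrow> (nat \<Rightarrow> nat) \<Rightarrow> complex \<Rightarrow> complex" where
  "charlier_eval r a n z = poly (map_poly complex_of_real (multiple_charlier r a n)) z"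

definition floor_index :: "(nat \<Rightarrow> real) \<Rightarrow> nat \<Rightarrow> nat \<Rightarrow> nat" where
  "floor_index q n = (\<lambda>j. nat \<lfloor>q j * real n\<rfloor>)"

end

theory Submission
  imports Defs
begin

text \<open>
  Let \<open>falling\<close> be the linear map on polynomials that sends \<open>y\<^sup>m\<close> to the falling factorial
  \<open>x (x - 1) \<dots> (x - m + 1)\<close>. Factorial moments of the Poisson distribution are pure powers, that is,
  \<open>\<Sum>k. falling P k * a\<^sup>k / k! = exp a * P a\<close>, and multiplication by \<open>x\<close> corresponds under \<open>falling\<close> to
  the operator \<open>P \<mapsto> y (P + P')\<close>. Hence the orthogonality conditions at \<open>a\<^sub>j\<close> say exactly that \<open>a\<^sub>j\<close> is a
  zero of \<open>P\<close> of multiplicity at least \<open>n\<^sub>j\<close>, and the multiple Charlier polynomial is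
  \<open>falling (\<Prod>j. (y - a\<^sub>j) ^ n\<^sub>j)\<close> (\<open>multiple_charlier_eq\<close>). Differentiating this product gives the
  nearest-neighbour recurrence (\<open>charlier_eval_recurrence\<close>)
  \<open>z C\<^sub>n = C\<^bsub>n+e_k\<^esub> + (a\<^sub>k + |n|) C\<^sub>n + (\<Sum>j. a\<^sub>j n\<^sub>j C\<^bsub>n-e_j\<^esub>)\<close>.

  Divided by \<open>C\<^sub>n\<close>, the recurrence expresses the ratio \<open>\<rho>\<^sub>k(n) = C\<^bsub>n+e_k\<^esub> / C\<^sub>n\<close> at \<open>z\<close> as
  \<open>z - a\<^sub>k - |n| - (\<Sum>j. a\<^sub>j n\<^sub>j / \<rho>\<^sub>j(n-e_j))\<close>. Two families of half-planes are invariant under this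
  recursion, and by induction they give \<open>|\<rho>| \<ge> |Im z|\<close> off the real axis and
  \<open>|\<rho>| \<ge> |Re z|\<close> when \<open>Re z \<le> 0\<close>; along the way \<open>C\<^sub>n(z)\<close> is seen to be nonzero. At the
  point \<open>N x\<close> with \<open>x\<close> in a compact set away from \<open>[0,\<infinity>)\<close>, all ratios therefore have modulus at least
  \<open>\<delta> N\<close>, and the sum in the recursion is bounded by \<open>(\<Sum>j. a\<^sub>j) |n| / (\<delta> N)\<close>. After division by \<open>N\<close>
  only \<open>x - |n| / N\<close> survives in the limit, and \<open>|n| / N\<close> tends to \<open>t\<close>.
\<close>

section \<open>The falling factorial transform\<close>

text \<open>The recursion behind this fold is \<open>y P(y) \<mapsto> x (falling P)(x - 1)\<close>, which reflects
  \<open>(x)\<^bsub>m+1\<^esub> = x (x - 1)\<^sub>m\<close> for falling factorials.\<close>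

definition falling :: "real poly \<Rightarrow> real poly" where
  "falling P = fold_coeffs (\<lambda>c q. pCons c (pcompose q [:-1, 1:])) P 0"

lemma falling_0 [simp]: "falling 0 = 0"
  by (simp add: falling_def)

lemma falling_pCons: "falling (pCons c P) = pCons c (pcompose (falling P) [:-1, 1:])"
proof (cases "c = 0 \<and> P = 0")
  case False
  then show ?thesis
    by (cases "c = 0") (auto simp: falling_def)
qed simp

lemma poly_falling_pCons [simp]:
  "poly (falling (pCons c P)) x = c + x * poly (falling P) (x - 1)"
  by (simp add: falling_pCons poly_pcompose)

lemma falling_add: "falling (P + Q) = falling P + falling Q"
proof (induction P arbitrary: Q)
  case (pCons c P)
  then show ?case
    by (cases Q) (simp add: falling_pCons pcompose_add)
qed simp

lemma falling_smult: "falling (smult c P) = smult c (falling P)"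
  by (induction P) (simp_all add: falling_pCons pcompose_smult)

lemma falling_sum: "falling (sum f A) = (\<Sum>i\<in>A. falling (f i))"
  by (induction A rule: infinite_finite_induct) (simp_all add: falling_add)

lemma falling_eq_0_iff [simp]: "falling P = 0 \<longleftrightarrow> P = 0"
  by (induction P) (auto simp: falling_pCons pcompose_eq_0_iff)

lemma falling_eq_iff [simp]: "falling P = falling Q \<longleftrightarrow> P = Q"
proof -
  have "falling (P - Q) = falling P - falling Q"
    using falling_add [of P "smult (-1) Q"] falling_smult [of "-1" Q] by simp
  then show ?thesis
    using falling_eq_0_iff [of "P - Q"] by simp
qed

lemma degree_falling [simp]: "degree (falling P) = degree P"
  by (induction P) (auto simp: falling_pCons degree_pcompose pcompose_eq_0_iff degree_pCons_eq_if)

lemma lead_coeff_falling: "lead_coeff (falling P) = lead_coeff P"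
proof (induction P)
  case (pCons c P)
  show ?case
  proof (cases "P = 0")
    case False
    have "lead_coeff (falling (pCons c P)) = lead_coeff (pcompose (falling P) [:-1, 1:])"
      using False unfolding falling_pCons by (subst lead_coeff_pCons) (auto simp: pcompose_eq_0_iff)
    also have "\<dots> = lead_coeff P"
      using pCons.IH by (subst lead_coeff_comp) auto
    finally show ?thesis
      using False by simp
  qed (simp add: falling_pCons)
qed simp

lemma falling_surj: "\<exists>P. p = falling P"
proof (induction "length (coeffs p)" arbitrary: p rule: less_induct)
  case less
  show ?case
  proof (cases "p = 0")
    case False
    obtain c q where p: "p = pCons c q"
      by (cases p) auto
    have "length (coeffs (pcompose q [:1, 1:])) < length (coeffs p)"
      using False
      by (cases "q = 0") (auto simp: length_coeffs_degree pcompose_eq_0_iff degree_pcompose p)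
    then obtain Q where "pcompose q [:1, 1:] = falling Q"
      using less by blast
    then have "falling (pCons c Q) = pCons c (pcompose (pcompose q [:1, 1:]) [:-1, 1:])"
      by (simp add: falling_pCons)
    also have "\<dots> = p"
      by (simp add: p pcompose_assoc [symmetric] pcompose_pCons)
    finally show ?thesis
      by metis
  qed (use falling_0 in metis)
qed

text \<open>Umbrally, a unit translation of falling factorials is the operator \<open>1 + d/dy\<close>, because
  \<open>(x + 1)\<^sub>m = (x)\<^sub>m + m (x)\<^bsub>m-1\<^esub>\<close>.\<close>

lemma poly_falling_shift: "poly (falling P) (x + 1) = poly (falling (P + pderiv P)) x"
proof (induction P arbitrary: x)
  case (pCons c P)
  have "pCons c P + pderiv (pCons c P) = P + pCons c (P + pderiv P)"
    by (simp add: pderiv_pCons)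
  then have "poly (falling (pCons c P + pderiv (pCons c P))) x =
      poly (falling P) x + (c + x * poly (falling (P + pderiv P)) (x - 1))"
    by (simp only: falling_add poly_add poly_falling_pCons)
  also have "\<dots> = poly (falling P) x + (c + x * poly (falling P) x)"
    using pCons.IH [of "x - 1"] by simp
  finally show ?case
    by (simp add: algebra_simps)
qed simp

text \<open>This is what multiplication by the variable becomes on the other side of \<open>falling\<close>.\<close>

definition mult_var :: "real poly \<Rightarrow> real poly" where
  "mult_var P = pCons 0 (P + pderiv P)"

lemma poly_falling_mult_var: "poly (falling (mult_var P)) x = x * poly (falling P) x"
  using poly_falling_shift [of P "x - 1"] by (simp add: mult_var_def)

section \<open>Poisson moments\<close>

text \<open>For \<open>P = y\<^sup>m\<close> this is the \<open>m\<close>-th factorial moment of the Poisson distribution: the factor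
  \<open>(k)\<^sub>m\<close> cancels against \<open>k!\<close> and leaves the exponential series multiplied by \<open>a\<^sup>m\<close>.\<close>

lemma falling_sums:
  "(\<lambda>k. poly (falling P) (real k) * (a ^ k / fact k)) sums (exp a * poly P a)"
proof (induction P)
  case (pCons c P)
  define f where "f = (\<lambda>k. real k * poly (falling P) (real k - 1) * (a ^ k / fact k))"
  have "f (Suc k) = a * (poly (falling P) (real k) * (a ^ k / fact k))" for k
    by (simp add: f_def field_simps del: of_nat_Suc) (simp add: algebra_simps)
  then have "(\<lambda>k. f (Suc k)) sums (a * (exp a * poly P a))"
    using sums_mult [OF pCons.IH, of a] by simp
  then have "f sums (a * (exp a * poly P a))"
    using sums_Suc [of f] by (simp add: f_def)
  moreover have "(\<lambda>k. c * (a ^ k / fact k)) sums (c * exp a)"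
    using sums_mult [OF exp_converges [of a], of c] by (simp add: field_simps)
  ultimately have "(\<lambda>k. c * (a ^ k / fact k) + f k) sums (c * exp a + a * (exp a * poly P a))"
    by (rule sums_add [rotated])
  then show ?case
    by (simp add: f_def algebra_simps)
qed simp

lemma falling_moment_sums:
  "(\<lambda>k. poly (falling P) (real k) * real k ^ l * (a ^ k / fact k)) sums
     (exp a * poly ((mult_var ^^ l) P) a)"
proof (induction l arbitrary: P)
  case 0
  then show ?case
    using falling_sums by simp
next
  case (Suc l)
  have "(mult_var ^^ Suc l) P = (mult_var ^^ l) (mult_var P)"
    by (simp add: funpow_swap1)
  moreover have "poly (falling (mult_var P)) (real k) * real k ^ l =
      poly (falling P) (real k) * real k ^ Suc l" for k
    by (simp add: poly_falling_mult_var)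
  ultimately show ?case
    using Suc [of "mult_var P"] by (simp only:)
qed

text \<open>At a nonzero point, \<open>mult_var\<close> lowers the multiplicity of a zero by exactly one, just as
  differentiation does: the term \<open>P\<close> in \<open>P + P'\<close> has higher order, and the factor \<open>y\<close> is invertible.\<close>

lemma linear_power_dvd_mult_var_iff:
  assumes "a \<noteq> 0" and "poly P a = 0"
  shows "[:-a, 1:] ^ m dvd mult_var P \<longleftrightarrow> [:-a, 1:] ^ Suc m dvd P"
proof (cases "P = 0")
  case False
  obtain Q where Q: "P = [:-a, 1:] ^ order a P * Q" "\<not> [:-a, 1:] dvd Q"
    using order_decomp [OF False] by blast
  obtain s where s: "order a P = Suc s"
    using False assms(2) order_root not0_implies_Suc by blast
  have P: "P = [:-a, 1:] ^ Suc s * Q"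
    using Q(1) s by simp
  \<comment> \<open>the cofactor left after splitting \<open>(y - a) ^ s\<close> off \<open>y (P + P')\<close>\<close>
  define R where "R = [:0, 1:] * ([:-a, 1:] * (Q + pderiv Q) + smult (real (Suc s)) Q)"
  have "mult_var P = [:0, 1:] * (P + pderiv P)"
    by (simp add: mult_var_def)
  also have "pderiv P = [:-a, 1:] ^ Suc s * pderiv Q + Q * smult (real (Suc s)) ([:-a, 1:] ^ s)"
    unfolding P by (simp only: pderiv_mult pderiv_power_Suc) (simp add: pderiv_pCons)
  also have "[:0, 1:] * (P + \<dots>) = [:-a, 1:] ^ s * R"
    unfolding P R_def by (intro poly_eq_poly_eq_iff [THEN iffD1] ext) (simp add: algebra_simps)
  finally have T: "mult_var P = [:-a, 1:] ^ s * R" .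
  have "poly Q a \<noteq> 0"
    using Q(2) by (simp add: poly_eq_0_iff_dvd)
  then have Ra: "poly R a \<noteq> 0"
    using assms(1) by (simp add: R_def)
  then have "R \<noteq> 0"
    by auto
  then have "order a (mult_var P) = s"
    using Ra unfolding T by (subst order_mult) (auto simp: order_power_n_n order_0I)
  moreover have "mult_var P \<noteq> 0"
    using \<open>R \<noteq> 0\<close> T by simp
  ultimately show ?thesis
    using False s by (simp add: order_divides del: power_Suc)
qed (simp add: mult_var_def)

lemma mult_var_vanish_iff:
  assumes "a \<noteq> 0"
  shows "(\<forall>l<m. poly ((mult_var ^^ l) P) a = 0) \<longleftrightarrow> [:-a, 1:] ^ m dvd P"
proof (induction m arbitrary: P)
  case (Suc m)
  have "(\<forall>l<Suc m. poly ((mult_var ^^ l) P) a = 0) \<longleftrightarrow>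
      poly P a = 0 \<and> (\<forall>l<m. poly ((mult_var ^^ l) (mult_var P)) a = 0)"
    by (auto simp: All_less_Suc2 funpow_swap1)
  also have "\<dots> \<longleftrightarrow> poly P a = 0 \<and> [:-a, 1:] ^ m dvd mult_var P"
    using Suc by simp
  also have "\<dots> \<longleftrightarrow> [:-a, 1:] ^ Suc m dvd P"
    using linear_power_dvd_mult_var_iff [OF assms, of P m]
    by (metis dvd_mult_left poly_eq_0_iff_dvd power_Suc)
  finally show ?case .
qed simp

section \<open>The explicit form of multiple Charlier polynomials\<close>

definition node_poly :: "nat \<Rightarrow> (nat \<Rightarrow> real) \<Rightarrow> (nat \<Rightarrow> nat) \<Rightarrow> real poly" where
  "node_poly r a n = (\<Prod>j = 1..r. [:-a j, 1:] ^ n j)"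

lemma degree_node_poly: "degree (node_poly r a n) = multi_size r n"
  unfolding node_poly_def multi_size_def
  by (subst degree_prod_eq_sum_degree) (auto simp: degree_linear_power)

lemma lead_coeff_node_poly: "lead_coeff (node_poly r a n) = 1"
  unfolding node_poly_def by (simp add: lead_coeff_prod lead_coeff_power)

lemma linear_powers_prod_dvd:
  fixes P :: "real poly"
  assumes "finite A" and "inj_on a A" and "\<And>j. j \<in> A \<Longrightarrow> [:-a j, 1:] ^ n j dvd P"
  shows "(\<Prod>j\<in>A. [:-a j, 1:] ^ n j) dvd P"
  using assms
proof (induction A rule: finite_induct)
  case (insert i A)
  let ?W = "\<Prod>j\<in>A. [:-a j, 1:] ^ n j"
  have "?W dvd P"
    using insert by simp
  then obtain S where S: "P = ?W * S" ..
  show ?case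
  proof (cases "P = 0")
    case False
    have "poly ?W (a i) \<noteq> 0"
      using insert.hyps insert.prems(1) by (auto simp: poly_prod inj_on_def)
    then have "order (a i) ?W = 0"
      by (rule order_0I)
    then have "order (a i) P = order (a i) S"
      using False unfolding S by (subst order_mult) auto
    moreover have "[:-a i, 1:] ^ n i dvd P"
      using insert.prems by simp
    ultimately have "[:-a i, 1:] ^ n i dvd S"
      using False by (auto simp: order_divides)
    then show ?thesis
      using insert.hyps by (simp add: S mult.commute mult_dvd_mono)
  qed simp
qed simp

text \<open>The conditions at \<open>a\<^sub>j\<close> only see the preimage \<open>P\<close> of the polynomial under \<open>falling\<close>, and ask that
  \<open>(y - a\<^sub>j) ^ n\<^sub>j\<close> divides it. Since the nodes are distinct, the product of these factors divides
  \<open>P\<close>; being monic of the same degree, \<open>P\<close> is that product.\<close>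

lemma is_multiple_charlier_iff:
  assumes pos: "\<forall>i\<in>{1..r}. a i > 0" and inj: "inj_on a {1..r}"
  shows "is_multiple_charlier r a n p \<longleftrightarrow> p = falling (node_poly r a n)"
proof -
  obtain P where p: "p = falling P"
    using falling_surj by blast
  have moment: "(\<lambda>k. poly p (real k) * real k ^ l * (a j ^ k / fact k)) sums 0 \<longleftrightarrow>
      poly ((mult_var ^^ l) P) (a j) = 0" for j l
    using falling_moment_sums [of P l "a j"] unfolding p by (auto dest: sums_unique2)
  have "(\<forall>l<n j. poly ((mult_var ^^ l) P) (a j) = 0) \<longleftrightarrow> [:-a j, 1:] ^ n j dvd P"
    if "j \<in> {1..r}" for j
    using mult_var_vanish_iff bspec [OF pos that] by simp
  then have "is_multiple_charlier r a n p \<longleftrightarrow> lead_coeff P = 1 \<and> degree P = multi_size r n \<and>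
      (\<forall>j\<in>{1..r}. [:-a j, 1:] ^ n j dvd P)"
    unfolding is_multiple_charlier_def moment
    by (simp only: p degree_falling lead_coeff_falling [unfolded degree_falling] cong: ball_cong)
  also have "\<dots> \<longleftrightarrow> P = node_poly r a n"
  proof (intro iffI)
    assume *: "lead_coeff P = 1 \<and> degree P = multi_size r n \<and>
      (\<forall>j\<in>{1..r}. [:-a j, 1:] ^ n j dvd P)"
    then have "node_poly r a n dvd P"
      unfolding node_poly_def using inj by (intro linear_powers_prod_dvd) auto
    then obtain S where S: "P = node_poly r a n * S" ..
    have "P \<noteq> 0"
      using * by auto
    then have "degree P = degree (node_poly r a n) + degree S"
      unfolding S by (intro degree_mult_eq) auto
    then have "degree S = 0"
      using * degree_node_poly by simp
    moreover have "lead_coeff S = 1"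
      using * lead_coeff_node_poly [of r a n] unfolding S by (simp add: lead_coeff_mult)
    ultimately have "S = 1"
      by (metis degree_0_id one_pCons)
    then show "P = node_poly r a n"
      using S by simp
  next
    assume P: "P = node_poly r a n"
    then show "lead_coeff P = 1 \<and> degree P = multi_size r n \<and>
      (\<forall>j\<in>{1..r}. [:-a j, 1:] ^ n j dvd P)"
      using lead_coeff_node_poly degree_node_poly by (auto simp: node_poly_def)
  qed
  also have "\<dots> \<longleftrightarrow> p = falling (node_poly r a n)"
    by (simp add: p)
  finally show ?thesis .
qed

lemma multiple_charlier_eq:
  assumes "\<forall>i\<in>{1..r}. a i > 0" and "inj_on a {1..r}"
  shows "multiple_charlier r a n = falling (node_poly r a n)"
  using is_multiple_charlier_iff [of r a n, OF assms] by (simp add: multiple_charlier_def)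

section \<open>The nearest-neighbour recurrence\<close>

lemma node_poly_add_unit:
  assumes "k \<in> {1..r}"
  shows "node_poly r a (\<lambda>j. n j + multi_unit k j) = [:-a k, 1:] * node_poly r a n"
proof -
  have "node_poly r a (\<lambda>j. n j + multi_unit k j) =
      (\<Prod>j = 1..r. [:-a j, 1:] ^ n j * (if j = k then [:-a k, 1:] else 1))"
    unfolding node_poly_def by (intro prod.cong) (auto simp: multi_unit_def)
  also have "\<dots> = node_poly r a n * [:-a k, 1:]"
    using assms by (simp only: prod.distrib prod.delta finite_atLeastAtMost if_True node_poly_def)
  finally show ?thesis
    by (simp only: mult.commute)
qed

text \<open>Logarithmic differentiation of the product: \<open>y (y - a\<^sub>j)\<inverse> = 1 + a\<^sub>j (y - a\<^sub>j)\<inverse>\<close>. If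
  \<open>n j = 0\<close>, the truncated subtraction is harmless because the coefficient vanishes.\<close>

lemma pCons_pderiv_node_poly:
  "pCons 0 (pderiv (node_poly r a n)) = smult (real (multi_size r n)) (node_poly r a n) +
     (\<Sum>j = 1..r. smult (a j * real (n j)) (node_poly r a (n(j := n j - 1))))"
proof -
  have summand: "[:0, 1:] * (prod (\<lambda>i. [:-a i, 1:] ^ n i) ({1..r} - {j}) * pderiv ([:-a j, 1:] ^ n j)) =
      smult (real (n j)) (node_poly r a n) +
      smult (a j * real (n j)) (node_poly r a (n(j := n j - 1)))" if j: "j \<in> {1..r}" for j
  proof (cases "n j")
    case 0
    then show ?thesis
      by simp
  next
    case (Suc m)
    let ?R = "prod (\<lambda>i. [:-a i, 1:] ^ n i) ({1..r} - {j})"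
    have 1: "node_poly r a n = [:-a j, 1:] ^ n j * ?R"
      unfolding node_poly_def using j by (intro prod.remove) auto
    have "node_poly r a (n(j := n j - 1)) = [:-a j, 1:] ^ m *
        prod (\<lambda>i. [:-a i, 1:] ^ (n(j := n j - 1)) i) ({1..r} - {j})"
      unfolding node_poly_def using j Suc by (subst prod.remove [of _ j]) auto
    also have "prod (\<lambda>i. [:-a i, 1:] ^ (n(j := n j - 1)) i) ({1..r} - {j}) = ?R"
      by (intro prod.cong) auto
    finally have 2: "node_poly r a (n(j := n j - 1)) = [:-a j, 1:] ^ m * ?R" .
    have 3: "pderiv ([:-a j, 1:] ^ n j) = smult (real (n j)) ([:-a j, 1:] ^ m)"
      unfolding Suc pderiv_power_Suc by (simp add: pderiv_pCons)
    show ?thesis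
      unfolding 1 2 3 unfolding Suc by (intro poly_eq_poly_eq_iff [THEN iffD1] ext) (simp add: algebra_simps)
  qed
  have "pCons 0 (pderiv (node_poly r a n)) = [:0, 1:] * pderiv (node_poly r a n)"
    by simp
  also have "\<dots> = (\<Sum>j = 1..r. [:0, 1:] *
      (prod (\<lambda>i. [:-a i, 1:] ^ n i) ({1..r} - {j}) * pderiv ([:-a j, 1:] ^ n j)))"
    unfolding node_poly_def pderiv_prod by (simp only: sum_distrib_left)
  also have "\<dots> = (\<Sum>j = 1..r. smult (real (n j)) (node_poly r a n) +
      smult (a j * real (n j)) (node_poly r a (n(j := n j - 1))))"
    by (intro sum.cong refl summand)
  finally show ?thesis
    by (simp add: sum.distrib multi_size_def smult_sum)
qed

lemma mult_var_node_poly: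
  assumes "k \<in> {1..r}"
  shows "mult_var (node_poly r a n) = node_poly r a (\<lambda>j. n j + multi_unit k j) +
     smult (a k + real (multi_size r n)) (node_poly r a n) +
     (\<Sum>j = 1..r. smult (a j * real (n j)) (node_poly r a (n(j := n j - 1))))"
proof -
  have "mult_var (node_poly r a n) = pCons 0 (node_poly r a n) + pCons 0 (pderiv (node_poly r a n))"
    by (simp add: mult_var_def)
  then show ?thesis
    unfolding node_poly_add_unit [OF assms] pCons_pderiv_node_poly
    by (simp add: smult_add_left)
qed

lemma poly_of_real_add:
  "poly (map_poly complex_of_real (p + q)) z =
     poly (map_poly complex_of_real p) z + poly (map_poly complex_of_real q) z"
proof (induction p arbitrary: q)
  case (pCons c p)
  then show ?case
    by (cases q) (simp add: map_poly_pCons algebra_simps)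
qed simp

lemma poly_of_real_smult:
  "poly (map_poly complex_of_real (smult c p)) z = of_real c * poly (map_poly complex_of_real p) z"
  by (induction p) (simp_all add: map_poly_pCons algebra_simps)

lemma poly_of_real_sum:
  "poly (map_poly complex_of_real (sum f A)) z = (\<Sum>i\<in>A. poly (map_poly complex_of_real (f i)) z)"
  by (induction A rule: infinite_finite_induct) (simp_all add: poly_of_real_add)

lemma charlier_eval_recurrence:
  assumes pos: "\<forall>i\<in>{1..r}. a i > 0" and inj: "inj_on a {1..r}" and k: "k \<in> {1..r}"
  shows "z * charlier_eval r a n z = charlier_eval r a (\<lambda>j. n j + multi_unit k j) z +
     (of_real (a k) + of_nat (multi_size r n)) * charlier_eval r a n z +
     (\<Sum>j = 1..r. of_real (a j) * of_nat (n j) * charlier_eval r a (n(j := n j - 1)) z)"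
proof -
  have eval: "charlier_eval r a m z = poly (map_poly of_real (falling (node_poly r a m))) z" for m
    by (simp add: charlier_eval_def multiple_charlier_eq [of r a m, OF pos inj])
  have "pCons 0 (falling (node_poly r a n)) = falling (mult_var (node_poly r a n))"
    by (intro poly_eq_poly_eq_iff [THEN iffD1] ext) (simp add: poly_falling_mult_var)
  then have "z * charlier_eval r a n z =
      poly (map_poly of_real (falling (mult_var (node_poly r a n)))) z"
    by (simp add: eval map_poly_pCons flip: \<open>pCons 0 _ = _\<close>)
  then show ?thesis
    unfolding mult_var_node_poly [OF k]
    by (simp add: falling_add falling_smult falling_sum poly_of_real_add poly_of_real_smult
        poly_of_real_sum eval)
qed

section \<open>Lower bounds for ratios of neighbouring polynomials\<close>

lemma charlier_eval_size_0:
  assumes pos: "\<forall>i\<in>{1..r}. a i > 0" and inj: "inj_on a {1..r}"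
    and "multi_size r n = 0"
  shows "charlier_eval r a n z = 1"
proof -
  have "node_poly r a n = 1"
    using assms(3) by (auto simp: node_poly_def multi_size_def)
  moreover have "falling 1 = 1"
    by (simp add: one_pCons falling_pCons)
  ultimately show ?thesis
    by (simp add: charlier_eval_def multiple_charlier_eq [of r a n, OF pos inj])
qed

lemma charlier_ratio_recursion:
  assumes pos: "\<forall>i\<in>{1..r}. a i > 0" and inj: "inj_on a {1..r}" and k: "k \<in> {1..r}"
    and nz: "charlier_eval r a n z \<noteq> 0"
  shows "charlier_eval r a (\<lambda>j. n j + multi_unit k j) z / charlier_eval r a n z =
     z - of_real (a k) - of_nat (multi_size r n) -
     (\<Sum>j = 1..r. of_real (a j * real (n j)) /
        (charlier_eval r a n z / charlier_eval r a (n(j := n j - 1)) z))"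
proof -
  define S where "S = (\<Sum>j = 1..r. of_real (a j) * of_nat (n j) * charlier_eval r a (n(j := n j - 1)) z)"
  have "(\<Sum>j = 1..r. of_real (a j * real (n j)) /
        (charlier_eval r a n z / charlier_eval r a (n(j := n j - 1)) z)) = S / charlier_eval r a n z"
    by (simp add: S_def sum_divide_distrib)
  moreover have "charlier_eval r a (\<lambda>j. n j + multi_unit k j) z =
      (z - of_real (a k) - of_nat (multi_size r n)) * charlier_eval r a n z - S"
    using charlier_eval_recurrence [of r a k z n, OF pos inj k] by (simp add: S_def algebra_simps)
  ultimately show ?thesis
    using nz by (simp add: diff_divide_distrib)
qed

text \<open>The induction on the size of the multi-index common to both half-plane estimates below:
  regions \<open>G k\<close> that avoid 0 and are preserved by the ratio recursion contain all ratios. The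
  exclusion of 0 simultaneously propagates the non-vanishing of the polynomials at \<open>z\<close>.\<close>

lemma charlier_ratio_invariant:
  assumes pos: "\<forall>i\<in>{1..r}. a i > 0" and inj: "inj_on a {1..r}"
    and nz: "\<And>k. k \<in> {1..r} \<Longrightarrow> 0 \<notin> G k"
    and step: "\<And>k n w. k \<in> {1..r} \<Longrightarrow> (\<And>j. j \<in> {1..r} \<Longrightarrow> n j > 0 \<Longrightarrow> w j \<in> G j) \<Longrightarrow>
      z - of_real (a k) - of_nat (multi_size r n) - (\<Sum>j = 1..r. of_real (a j * real (n j)) / w j) \<in> G k"
  shows "charlier_eval r a n z \<noteq> 0 \<and>
    (\<forall>k\<in>{1..r}. charlier_eval r a (\<lambda>j. n j + multi_unit k j) z / charlier_eval r a n z \<in> G k)"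
proof (induction "multi_size r n" arbitrary: n rule: less_induct)
  case less
  have prev: "charlier_eval r a n z / charlier_eval r a (n(j := n j - 1)) z \<in> G j"
    if "j \<in> {1..r}" "n j > 0" for j
  proof -
    define n' where "n' = n(j := n j - 1)"
    have n': "(\<lambda>i. n' i + multi_unit j i) = n"
      using that by (auto simp: n'_def multi_unit_def)
    have "multi_size r n' < multi_size r n"
      unfolding multi_size_def n'_def using that by (intro sum_strict_mono_ex1) auto
    then have "charlier_eval r a (\<lambda>i. n' i + multi_unit j i) z / charlier_eval r a n' z \<in> G j"
      using less that(1) by blast
    then show ?thesis
      unfolding n' by (simp only: n'_def)
  qed
  have n_nz: "charlier_eval r a n z \<noteq> 0"
  proof (cases "multi_size r n = 0")
    case True
    then show ?thesis
      using charlier_eval_size_0 [of r a n z, OF pos inj] by simp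
  next
    case False
    then obtain j where "j \<in> {1..r}" "n j > 0"
      by (auto simp: multi_size_def)
    then show ?thesis
      using prev nz by fastforce
  qed
  have "charlier_eval r a (\<lambda>j. n j + multi_unit k j) z / charlier_eval r a n z \<in> G k"
    if "k \<in> {1..r}" for k
    unfolding charlier_ratio_recursion [OF pos inj that n_nz] by (rule step [OF that prev])
  then show ?case
    using n_nz by blast
qed

text \<open>The map \<open>w \<mapsto> - 1 / w\<close> preserves the upper and the lower half-plane, so every term of the
  recursion after \<open>z\<close> is real or has an imaginary part of the sign of \<open>Im z\<close>.\<close>

lemma charlier_ratio_norm_ge_Im:
  assumes pos: "\<forall>i\<in>{1..r}. a i > 0" and inj: "inj_on a {1..r}" and k: "k \<in> {1..r}"
    and z: "Im z \<noteq> 0"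
  shows "charlier_eval r a n z \<noteq> 0"
    and "norm (charlier_eval r a (\<lambda>j. n j + multi_unit k j) z / charlier_eval r a n z) \<ge> \<bar>Im z\<bar>"
proof -
  define G :: "nat \<Rightarrow> complex set" where "G = (\<lambda>k. {w. Im w / Im z \<ge> 1})"
  have *: "charlier_eval r a n z \<noteq> 0 \<and>
    (\<forall>k\<in>{1..r}. charlier_eval r a (\<lambda>j. n j + multi_unit k j) z / charlier_eval r a n z \<in> G k)"
  proof (rule charlier_ratio_invariant [OF pos inj])
    fix k and n :: "nat \<Rightarrow> nat" and w :: "nat \<Rightarrow> complex"
    assume w: "\<And>j. j \<in> {1..r} \<Longrightarrow> n j > 0 \<Longrightarrow> w j \<in> G j"
    have "Im (of_real (a j * real (n j)) / w j) / Im z \<le> 0" if j: "j \<in> {1..r}" for j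
    proof (cases "n j > 0")
      case True
      have "Im (of_real (a j * real (n j)) / w j) / Im z =
          - (a j * real (n j) / (cmod (w j))\<^sup>2) * (Im (w j) / Im z)"
        by (simp add: Im_divide cmod_power2)
      moreover have "a j * real (n j) / (cmod (w j))\<^sup>2 * (Im (w j) / Im z) \<ge> 0"
        using bspec [OF pos j] w [OF j True] by (intro mult_nonneg_nonneg) (auto simp: G_def)
      ultimately show ?thesis
        by simp
    qed simp
    then have "(\<Sum>j = 1..r. Im (of_real (a j * real (n j)) / w j) / Im z) \<le> 0"
      by (intro sum_nonpos) auto
    then show "z - of_real (a k) - of_nat (multi_size r n) -
        (\<Sum>j = 1..r. of_real (a j * real (n j)) / w j) \<in> G k"
      using z by (simp add: G_def diff_divide_distrib sum_divide_distrib Im_sum del: of_real_mult)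
  qed (auto simp: G_def)
  then show "charlier_eval r a n z \<noteq> 0"
    by blast
  let ?\<rho> = "charlier_eval r a (\<lambda>j. n j + multi_unit k j) z / charlier_eval r a n z"
  have "1 \<le> Im ?\<rho> / Im z"
    using * k by (auto simp: G_def)
  also have "\<dots> \<le> \<bar>Im ?\<rho>\<bar> / \<bar>Im z\<bar>"
    by (metis abs_divide abs_ge_self)
  finally have "\<bar>Im z\<bar> \<le> \<bar>Im ?\<rho>\<bar>"
    using z by (simp add: le_divide_eq_1)
  then show "\<bar>Im z\<bar> \<le> norm ?\<rho>"
    using abs_Im_le_cmod order_trans by blast
qed

text \<open>In the left half-plane the terms \<open>- a\<^sub>j n\<^sub>j / w\<^sub>j\<close> of the recursion push the real part to the right,
  but by at most \<open>n\<^sub>j\<close> each if \<open>|w\<^sub>j| \<ge> a\<^sub>j\<close>. The term \<open>- |n|\<close> absorbs this push,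
  which makes the half-planes \<open>Re w \<le> Re z - a\<^sub>k\<close> invariant.\<close>

lemma charlier_ratio_norm_ge_Re:
  assumes pos: "\<forall>i\<in>{1..r}. a i > 0" and inj: "inj_on a {1..r}" and k: "k \<in> {1..r}"
    and z: "Re z \<le> 0"
  shows "charlier_eval r a n z \<noteq> 0"
    and "norm (charlier_eval r a (\<lambda>j. n j + multi_unit k j) z / charlier_eval r a n z) \<ge> \<bar>Re z\<bar>"
proof -
  define G :: "nat \<Rightarrow> complex set" where "G = (\<lambda>k. {w. Re w \<le> Re z - a k})"
  have *: "charlier_eval r a n z \<noteq> 0 \<and>
    (\<forall>k\<in>{1..r}. charlier_eval r a (\<lambda>j. n j + multi_unit k j) z / charlier_eval r a n z \<in> G k)"
  proof (rule charlier_ratio_invariant [OF pos inj])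
    show "0 \<notin> G k" if "k \<in> {1..r}" for k
      using bspec [OF pos that] z by (simp add: G_def)
    fix k and n :: "nat \<Rightarrow> nat" and w :: "nat \<Rightarrow> complex"
    assume w: "\<And>j. j \<in> {1..r} \<Longrightarrow> n j > 0 \<Longrightarrow> w j \<in> G j"
    have "- Re (of_real (a j * real (n j)) / w j) \<le> real (n j)" if j: "j \<in> {1..r}" for j
    proof (cases "n j > 0")
      case True
      have "a j \<le> - Re (w j)"
        using w [OF j True] z by (simp add: G_def)
      also have "\<dots> \<le> norm (w j)"
        using abs_Re_le_cmod [of "w j"] by linarith
      finally have aw: "a j \<le> norm (w j)" .
      have "- Re (of_real (a j * real (n j)) / w j) \<le> norm (of_real (a j * real (n j)) / w j)"
        using abs_Re_le_cmod [of "of_real (a j * real (n j)) / w j"] by linarith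
      also have "\<dots> = a j / norm (w j) * real (n j)"
        using bspec [OF pos j] by (simp add: norm_divide norm_mult)
      also have "\<dots> \<le> 1 * real (n j)"
        using aw bspec [OF pos j] by (intro mult_right_mono) (auto simp: divide_le_eq_1)
      finally show ?thesis
        by simp
    qed simp
    then have "(\<Sum>j = 1..r. - Re (of_real (a j * real (n j)) / w j)) \<le> real (multi_size r n)"
      unfolding multi_size_def of_nat_sum by (intro sum_mono) auto
    then show "z - of_real (a k) - of_nat (multi_size r n) -
        (\<Sum>j = 1..r. of_real (a j * real (n j)) / w j) \<in> G k"
      by (simp add: G_def Re_sum sum_negf del: of_real_mult)
  qed
  then show "charlier_eval r a n z \<noteq> 0"
    by blast
  let ?\<rho> = "charlier_eval r a (\<lambda>j. n j + multi_unit k j) z / charlier_eval r a n z"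
  have "Re ?\<rho> \<le> Re z - a k"
    using * k by (auto simp: G_def)
  then have "\<bar>Re z\<bar> \<le> \<bar>Re ?\<rho>\<bar>"
    using bspec [OF pos k] z by linarith
  then show "\<bar>Re z\<bar> \<le> norm ?\<rho>"
    using abs_Re_le_cmod order_trans by blast
qed

lemma charlier_ratio_norm_ge:
  assumes pos: "\<forall>i\<in>{1..r}. a i > 0" and inj: "inj_on a {1..r}" and k: "k \<in> {1..r}"
    and "d > 0" and "\<bar>Im z\<bar> \<ge> d \<or> Re z \<le> - d"
  shows "charlier_eval r a n z \<noteq> 0"
    and "norm (charlier_eval r a (\<lambda>j. n j + multi_unit k j) z / charlier_eval r a n z) \<ge> d"
proof -
  consider "Im z \<noteq> 0" "\<bar>Im z\<bar> \<ge> d" | "Re z \<le> 0" "\<bar>Re z\<bar> \<ge> d"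
    using assms(4,5) by force
  then have "charlier_eval r a n z \<noteq> 0 \<and>
      norm (charlier_eval r a (\<lambda>j. n j + multi_unit k j) z / charlier_eval r a n z) \<ge> d"
    using charlier_ratio_norm_ge_Im [of r a k z n, OF pos inj k]
      charlier_ratio_norm_ge_Re [of r a k z n, OF pos inj k]
    by cases (meson order_trans)+
  then show "charlier_eval r a n z \<noteq> 0"
    and "norm (charlier_eval r a (\<lambda>j. n j + multi_unit k j) z / charlier_eval r a n z) \<ge> d"
    by auto
qed

section \<open>Ratio asymptotics\<close>

text \<open>The lower bounds apply to every denominator in the ratio recursion, including those at the smaller
  multi-indices \<open>n - e\<^sub>j\<close>, with the same \<open>d\<close>. At the points \<open>N x\<close> both \<open>d\<close> and \<open>|n|\<close> are of order
  \<open>N\<close>, so the right-hand side stays bounded.\<close>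

lemma charlier_ratio_approx:
  assumes pos: "\<forall>i\<in>{1..r}. a i > 0" and inj: "inj_on a {1..r}" and k: "k \<in> {1..r}"
    and d: "d > 0" and z: "\<bar>Im z\<bar> \<ge> d \<or> Re z \<le> - d"
  shows "norm (charlier_eval r a (\<lambda>j. n j + multi_unit k j) z / charlier_eval r a n z -
      (z - of_nat (multi_size r n))) \<le> a k + (\<Sum>j = 1..r. a j) * real (multi_size r n) / d"
proof -
  define w where "w = (\<lambda>j. charlier_eval r a n z / charlier_eval r a (n(j := n j - 1)) z)"
  note nz = charlier_ratio_norm_ge(1) [OF pos inj k d z]
  have summand: "norm (complex_of_real (a j * real (n j)) / w j) \<le> a j * real (multi_size r n) / d"
    if j: "j \<in> {1..r}" for j
  proof (cases "n j > 0")
    case True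
    then have "(\<lambda>i. (n(j := n j - 1)) i + multi_unit j i) = n"
      by (auto simp: multi_unit_def)
    then have "norm (w j) \<ge> d"
      using charlier_ratio_norm_ge(2) [OF pos inj j d z, of "n(j := n j - 1)"] by (simp add: w_def)
    moreover have "n j \<le> multi_size r n"
      unfolding multi_size_def using j by (intro member_le_sum) auto
    ultimately have "a j * real (n j) / norm (w j) \<le> a j * real (multi_size r n) / d"
      using bspec [OF pos j] d by (intro frac_le mult_left_mono) auto
    then show ?thesis
      using bspec [OF pos j] by (simp add: norm_divide norm_mult)
  next
    case False
    then show ?thesis
      using bspec [OF pos j] d by simp
  qed
  let ?S = "\<Sum>j = 1..r. complex_of_real (a j * real (n j)) / w j"
  have "norm ?S \<le> (\<Sum>j = 1..r. a j * real (multi_size r n) / d)"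
    by (intro sum_norm_le summand)
  also have "\<dots> = (\<Sum>j = 1..r. a j) * real (multi_size r n) / d"
    by (simp add: sum_distrib_right sum_divide_distrib)
  finally have S: "norm ?S \<le> (\<Sum>j = 1..r. a j) * real (multi_size r n) / d" .
  have "charlier_eval r a (\<lambda>j. n j + multi_unit k j) z / charlier_eval r a n z -
      (z - of_nat (multi_size r n)) = - (of_real (a k) + ?S)"
    unfolding charlier_ratio_recursion [of r a k n z, OF pos inj k nz] w_def by simp
  then have "norm (charlier_eval r a (\<lambda>j. n j + multi_unit k j) z / charlier_eval r a n z -
      (z - of_nat (multi_size r n))) = norm (of_real (a k) + ?S)"
    by (simp only: norm_minus_cancel)
  also have "\<dots> \<le> norm (complex_of_real (a k)) + norm ?S"
    by (rule norm_triangle_ineq)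
  finally show ?thesis
    using S bspec [OF pos k] by simp
qed

text \<open>Positive distance from \<open>[0,\<infinity>)\<close>, in the form that selects between the two half-plane estimates.\<close>

lemma compact_away_from_nonneg_reals:
  assumes "compact K" and "K \<subseteq> - (complex_of_real ` {0..})"
  obtains d where "d > 0" and "\<And>x. x \<in> K \<Longrightarrow> \<bar>Im x\<bar> \<ge> d \<or> Re x \<le> - d"
proof -
  have "complex_of_real ` {0..} = \<real>\<^sub>\<ge>\<^sub>0"
    by (auto simp: nonneg_Reals_def)
  then have "closed (complex_of_real ` {0..})"
    by simp
  then obtain d where d: "d > 0" "\<And>x y. x \<in> K \<Longrightarrow> y \<in> complex_of_real ` {0..} \<Longrightarrow> d \<le> dist x y"
    using separate_compact_closed [OF assms(1), of "complex_of_real ` {0..}"] assms(2) by blast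
  \<comment> \<open>compare \<open>x\<close> with the point of \<open>[0,\<infinity>)\<close> nearest to it\<close>
  have "\<bar>Im x\<bar> \<ge> d / 2 \<or> Re x \<le> - (d / 2)" if x: "x \<in> K" for x
  proof -
    have "d \<le> norm (x - of_real (max 0 (Re x)))"
      using d(2) [OF x, of "of_real (max 0 (Re x))"] by (simp add: dist_norm)
    also have "\<dots> \<le> \<bar>Re x - max 0 (Re x)\<bar> + \<bar>Im x\<bar>"
      using cmod_le [of "x - of_real (max 0 (Re x))"] by simp
    finally show ?thesis
      by (auto simp: max_def split: if_splits)
  qed
  then show thesis
    using that [of "d / 2"] d(1) by auto
qed

lemma floor_index_size_limit:
  fixes n N :: "nat \<Rightarrow> nat"
  assumes q_nonneg: "\<And>j. j \<in> {1..r} \<Longrightarrow> 0 \<le> q j"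
    and q_sum: "(\<Sum>j = 1..r. q j) = 1"
    and N_lim: "filterlim N at_top sequentially"
    and ratio_lim: "(\<lambda>m. real (n m) / real (N m)) \<longlonglongrightarrow> t"
  shows "(\<lambda>m. real (multi_size r (floor_index q (n m))) / real (N m)) \<longlonglongrightarrow> t"
proof -
  have invN: "(\<lambda>m. 1 / real (N m)) \<longlonglongrightarrow> 0"
    using filterlim_compose [OF lim_1_over_n N_lim] by simp
  have "(\<lambda>m. real (floor_index q (n m) j) / real (N m)) \<longlonglongrightarrow> q j * t" if j: "j \<in> {1..r}" for j
  proof (rule Lim_transform2)
    show "(\<lambda>m. q j * (real (n m) / real (N m))) \<longlonglongrightarrow> q j * t"
      by (intro tendsto_mult_left ratio_lim)
    have "norm (q j * (real (n m) / real (N m)) - real (floor_index q (n m) j) / real (N m))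
        \<le> 1 / real (N m)" for m
    proof -
      have "\<bar>q j * real (n m) - real (floor_index q (n m) j)\<bar> \<le> 1"
        using q_nonneg [OF j] unfolding floor_index_def by (simp add: of_nat_nat) linarith
      then have "\<bar>q j * real (n m) - real (floor_index q (n m) j)\<bar> / real (N m) \<le> 1 / real (N m)"
        by (intro divide_right_mono) auto
      then show ?thesis
        by (simp add: abs_divide flip: diff_divide_distrib)
    qed
    then show "(\<lambda>m. q j * (real (n m) / real (N m)) - real (floor_index q (n m) j) / real (N m)) \<longlonglongrightarrow> 0"
      by (intro Lim_null_comparison [OF _ invN]) auto
  qed
  then have "(\<lambda>m. \<Sum>j = 1..r. real (floor_index q (n m) j) / real (N m)) \<longlonglongrightarrow> (\<Sum>j = 1..r. q j * t)"
    by (intro tendsto_sum) auto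
  then show ?thesis
    using q_sum by (simp add: multi_size_def sum_divide_distrib flip: sum_distrib_right)
qed

theorem theorem3p1:
  fixes r k :: nat and a q :: "nat \<Rightarrow> real" and t :: real
    and n N :: "nat \<Rightarrow> nat" and K :: "complex set"
  assumes a_pos: "\<And>i. i \<in> {1..r} \<Longrightarrow> a i > 0"
    and a_distinct: "\<And>i j. i \<in> {1..r} \<Longrightarrow> j \<in> {1..r} \<Longrightarrow> i \<noteq> j \<Longrightarrow> a i \<noteq> a j"
    and q_range: "\<And>j. j \<in> {1..r} \<Longrightarrow> 0 < q j \<and> q j < 1"
    and q_sum: "(\<Sum>j = 1..r. q j) = 1"
    and t_pos: "t > 0"
    and k_range: "k \<in> {1..r}"
    and n_lim: "filterlim n at_top sequentially"
    and N_lim: "filterlim N at_top sequentially"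
    and ratio_lim: "(\<lambda>m. real (n m) / real (N m)) \<longlonglongrightarrow> t"
    and K_compact: "compact K"
    and K_disjoint: "K \<subseteq> - (complex_of_real ` {0..})"
  shows "uniform_limit K
           (\<lambda>m x. charlier_eval r a (\<lambda>j. floor_index q (n m) j + multi_unit k j) (of_nat (N m) * x) /
                  (of_nat (N m) * charlier_eval r a (floor_index q (n m)) (of_nat (N m) * x)))
           (\<lambda>x. x - complex_of_real t) sequentially"
proof -
  have pos: "\<forall>i\<in>{1..r}. a i > 0"
    using a_pos by blast
  have inj: "inj_on a {1..r}"
    using a_distinct by (meson inj_onI)
  obtain d where d: "d > 0" and K: "\<And>x. x \<in> K \<Longrightarrow> \<bar>Im x\<bar> \<ge> d \<or> Re x \<le> - d"
    using compact_away_from_nonneg_reals [OF K_compact K_disjoint] by blast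
  define s where "s = (\<lambda>m. multi_size r (floor_index q (n m)))"
  define A where "A = (\<Sum>j = 1..r. a j)"
  \<comment> \<open>an error bound independent of \<open>x \<in> K\<close>: the estimate of \<open>charlier_ratio_approx\<close> for
      \<open>d\<close> scaled by \<open>N\<close>, divided by \<open>N\<close>, and the deviation of \<open>|n| / N\<close> from \<open>t\<close>\<close>
  define b where "b = (\<lambda>m. a k * (1 / real (N m)) +
      A / d * (real (s m) / real (N m)) * (1 / real (N m)) + \<bar>t - real (s m) / real (N m)\<bar>)"
  have invN: "(\<lambda>m. 1 / real (N m)) \<longlonglongrightarrow> 0"
    using filterlim_compose [OF lim_1_over_n N_lim] by simp
  have s_lim: "(\<lambda>m. real (s m) / real (N m)) \<longlonglongrightarrow> t"
    unfolding s_def using q_range by (intro floor_index_size_limit [OF _ q_sum N_lim ratio_lim] less_imp_le) blast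
  have "b \<longlonglongrightarrow> a k * 0 + A / d * t * 0 + \<bar>t - t\<bar>"
    unfolding b_def by (intro tendsto_intros invN s_lim)
  then have b_lim: "b \<longlonglongrightarrow> 0"
    by simp
  have bound: "norm (charlier_eval r a (\<lambda>j. floor_index q (n m) j + multi_unit k j) (of_nat (N m) * x) /
        (of_nat (N m) * charlier_eval r a (floor_index q (n m)) (of_nat (N m) * x)) -
        (x - complex_of_real t)) \<le> b m" if x: "x \<in> K" and N: "N m > 0" for m x
  proof -
    define z where "z = of_nat (N m) * x"
    define \<rho> where "\<rho> = charlier_eval r a (\<lambda>j. floor_index q (n m) j + multi_unit k j) z /
        charlier_eval r a (floor_index q (n m)) z"
    have "real (N m) * d \<le> real (N m) * \<bar>Im x\<bar> \<or> real (N m) * Re x \<le> real (N m) * (- d)"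
      using K [OF x] by (meson mult_left_mono of_nat_0_le_iff)
    then have "\<bar>Im z\<bar> \<ge> real (N m) * d \<or> Re z \<le> - (real (N m) * d)"
      by (simp add: z_def abs_mult)
    then have "norm (\<rho> - (z - of_nat (s m))) \<le> a k + A * real (s m) / (real (N m) * d)"
      unfolding \<rho>_def s_def A_def
      using d N by (intro charlier_ratio_approx [OF pos inj k_range]) auto
    then have "norm (\<rho> - (z - of_nat (s m))) / real (N m) \<le>
        (a k + A * real (s m) / (real (N m) * d)) / real (N m)"
      by (intro divide_right_mono) auto
    also have "\<dots> = a k * (1 / real (N m)) + A / d * (real (s m) / real (N m)) * (1 / real (N m))"
      by (simp add: add_divide_distrib mult.commute)
    finally have 1: "norm ((\<rho> - (z - of_nat (s m))) / of_nat (N m)) \<le>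
        a k * (1 / real (N m)) + A / d * (real (s m) / real (N m)) * (1 / real (N m))"
      by (simp add: norm_divide)
    have "\<rho> / of_nat (N m) - (x - of_real t) =
        (\<rho> - (z - of_nat (s m))) / of_nat (N m) + of_real (t - real (s m) / real (N m))"
      using N by (simp add: z_def field_simps)
    also have "norm \<dots> \<le> norm ((\<rho> - (z - of_nat (s m))) / of_nat (N m)) +
        norm (complex_of_real (t - real (s m) / real (N m)))"
      by (rule norm_triangle_ineq)
    also have "\<dots> \<le> b m"
      using 1 unfolding b_def norm_of_real by linarith
    finally show ?thesis
      by (simp add: \<rho>_def z_def mult.commute)
  qed
  show ?thesis
  proof (rule uniform_limitI)
    fix e :: real
    assume "e > 0"
    then have "\<forall>\<^sub>F m in sequentially. b m < e"
      using b_lim by (rule order_tendstoD(2) [rotated])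
    moreover have "\<forall>\<^sub>F m in sequentially. N m \<ge> 1"
      using N_lim unfolding filterlim_at_top by blast
    ultimately show "\<forall>\<^sub>F m in sequentially. \<forall>x\<in>K.
        dist (charlier_eval r a (\<lambda>j. floor_index q (n m) j + multi_unit k j) (of_nat (N m) * x) /
          (of_nat (N m) * charlier_eval r a (floor_index q (n m)) (of_nat (N m) * x)))
          (x - complex_of_real t) < e"
    proof eventually_elim
      case (elim m)
      then show ?case
        unfolding dist_norm by (intro ballI le_less_trans [OF bound]) auto
    qed
  qed
qed

end
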